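(* Let $p(\cdot\mid z)$ be a likelihood on datasets with $p(\mathcal{A}+\mathcal{B}\mid z)=p(\mathcal{A}\mid z)p(\mathcal{B}\mid z)$ for all datasets $\mathcal{A},\mathcal{B}$. Let $q_{\mathcal{D}}(z)$ be a probability density (an approximate posterior given a dataset $\mathcal{D}$), let $\mathcal{D}^*$ be a dataset, let $K\ge1$, let $z_1,\dots,z_K$ be i.i.d. samples from $q_{\mathcal{D}}$, and let $R_K=\frac1K\sum_{k=1}^Kp(\mathcal{D}^*\mid z_k)$. Then $$\mathrm{SNR}(R_K)=\frac{\sqrt K}{\sqrt{\exp(\delta)^2-1}},$$ where $$\delta=\tfrac12\mathrm{KL}\big(q_{\mathcal{D}}(z\mid\mathcal{D}^* )\,\|\,q_{\mathcal{D}}(z)\big)+\tfrac12\mathrm{KL}\big(q_{\mathcal{D}}(z\mid\mathcal{D}^* )\,\|\,q_{\mathcal{D}}(z\mid2\mathcal{D}^* )\big)=\tfrac12Z_{\mathcal{D}}(2\mathcal{D}^* )-Z_{\mathcal{D}}(\mathcal{D}^* ),$$ with $Z_{\mathcal{D}}(\mathcal{D}^* )=\log\int p(\mathcal{D}^*\mid z)q_{\mathcal{D}}(z)\,dz$ and $q_{\mathcal{D}}(z\mid\mathcal{D}^* )\propto p(\mathcal{D}^*\mid z)q_{\mathcal{D}}(z)$ (normalized to a probability density).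
   Context: Datasets are finite multisets: $+$ is multiset addition and $2\mathcal{D}^*=\mathcal{D}^*+\mathcal{D}^*$, so $p(2\mathcal{D}^*\mid z)=p(\mathcal{D}^*\mid z)^2$. The densities $q_{\mathcal{D}}(\cdot\mid\mathcal{D}^* )$ and $q_{\mathcal{D}}(\cdot\mid2\mathcal{D}^* )$ are assumed well defined, i.e. $\int p(\mathcal{D}^*\mid z)q_{\mathcal{D}}(z)\,dz$ and $\int p(2\mathcal{D}^*\mid z)q_{\mathcal{D}}(z)\,dz$ lie in $(0,\infty)$. $\mathrm{SNR}(R)=\mathbb{E}[R]/\sqrt{\mathbb{V}[R]}$ ($\mathbb V$ the variance), read as $+\infty$ when $\mathbb{V}[R]=0$ (equivalently $\delta=0$). $\mathrm{KL}(a\|b)=\int a(z)\log\frac{a(z)}{b(z)}\,dz$. *)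

theory Defs
  imports "HOL-Probability.Probability" "HOL-Library.Multiset"
begin

text \<open>
  The latent variable ranges over a measure space \<open>M\<close>, whose measure plays the role of \<open>dz\<close>
  (for instance \<open>lborel\<close> on a Euclidean space); densities are taken with respect to \<open>M\<close>.
\<close>

definition prob_density :: "'z measure \<Rightarrow> ('z \<Rightarrow> real) \<Rightarrow> bool" where
  "prob_density M q \<longleftrightarrow>
     q \<in> borel_measurable M \<and> (\<forall>z\<in>space M. 0 \<le> q z) \<and> (\<integral>\<^sup>+ z. ennreal (q z) \<partial>M) = 1"

text \<open>\<open>p A z\<close> stands for \<open>p(A | z)\<close>. Since there is no normalisation over the set of all finite
  multisets, a likelihood is only required to be nonnegative, measurable in \<open>z\<close>, and
  multiplicative in the dataset.\<close>

definition factorizing_likelihood :: "'z measure \<Rightarrow> ('x multiset \<Rightarrow> 'z \<Rightarrow> real) \<Rightarrow> bool" where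
  "factorizing_likelihood M p \<longleftrightarrow>
     (\<forall>A. p A \<in> borel_measurable M) \<and>
     (\<forall>A. \<forall>z\<in>space M. 0 \<le> p A z) \<and>
     (\<forall>A B. \<forall>z\<in>space M. p (A + B) z = p A z * p B z)"

definition posterior ::
  "'z measure \<Rightarrow> ('x multiset \<Rightarrow> 'z \<Rightarrow> real) \<Rightarrow> ('z \<Rightarrow> real) \<Rightarrow> 'x multiset \<Rightarrow> 'z \<Rightarrow> real" where
  "posterior M p q A z = p A z * q z / (\<integral>w. p A w * q w \<partial>M)"

definition log_evidence ::
  "'z measure \<Rightarrow> ('x multiset \<Rightarrow> 'z \<Rightarrow> real) \<Rightarrow> ('z \<Rightarrow> real) \<Rightarrow> 'x multiset \<Rightarrow> real" where
  "log_evidence M p q A = ln (\<integral>z. p A z * q z \<partial>M)"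

text \<open>
  Kullback-Leibler divergence of probability densities. The Bochner integral is \<open>0\<close> on
  non-integrable functions and \<open>ln (a / 0) = 0\<close>, so the infinite case is split off explicitly:
  for probability densities the negative part of the integrand is always integrable, hence the
  divergence is \<open>\<infinity>\<close> whenever the integrand is not integrable or absolute continuity fails.
  The convention \<open>0 log (0 / b) = 0\<close> holds automatically.
\<close>

definition KL :: "'z measure \<Rightarrow> ('z \<Rightarrow> real) \<Rightarrow> ('z \<Rightarrow> real) \<Rightarrow> ereal" where
  "KL M a b =
     (if (AE z in M. b z = 0 \<longrightarrow> a z = 0) \<and> integrable M (\<lambda>z. a z * ln (a z / b z))
      then ereal (\<integral>z. a z * ln (a z / b z) \<partial>M) else \<infinity>)"

text \<open>
  Signal-to-noise ratio of a random variable \<open>X\<close> on a probability space \<open>P\<close>; it is \<open>\<infinity>\<close> when the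
  variance vanishes. The last case (infinite variance) keeps the value \<open>0\<close> of a non-existing
  Bochner integral from being mistaken for a vanishing variance.
\<close>

definition SNR :: "'w measure \<Rightarrow> ('w \<Rightarrow> real) \<Rightarrow> ereal" where
  "SNR P X =
     (if integrable P X \<and> integrable P (\<lambda>\<omega>. (X \<omega>)\<^sup>2) then
        (if prob_space.variance P X = 0 then \<infinity>
         else ereal (prob_space.expectation P X / sqrt (prob_space.variance P X)))
      else 0)"

definition mc_estimator ::
  "('x multiset \<Rightarrow> 'z \<Rightarrow> real) \<Rightarrow> 'x multiset \<Rightarrow> nat \<Rightarrow> (nat \<Rightarrow> 'w \<Rightarrow> 'z) \<Rightarrow> 'w \<Rightarrow> real" where
  "mc_estimator p A K z \<omega> = 1 / real K * (\<Sum>k=1..K. p A (z k \<omega>))"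

end

theory Submission
  imports Defs
begin

text \<open>
  Write \<open>c\<^sub>1\<close> and \<open>c\<^sub>2\<close> for the first two moments of \<open>p(D* | \<cdot>)\<close> under \<open>q\<close>. The two divergences are
  \<open>L / c\<^sub>1 - ln c\<^sub>1\<close> and \<open>ln c\<^sub>2 - ln c\<^sub>1 - L / c\<^sub>1\<close>, where \<open>L\<close> is the integral of \<open>p ln p\<close> against
  \<open>q\<close>; \<open>L\<close> is finite since \<open>\<bar>t ln t\<bar> \<le> 1 + t\<^sup>2\<close>. It cancels in the sum, so that
  \<open>exp \<delta> ^ 2 = c\<^sub>2 / c\<^sub>1 ^ 2\<close>, while independence gives the variance \<open>(c\<^sub>2 - c\<^sub>1 ^ 2) / K\<close>.
\<close>

section \<open>Integrability of the logarithmic moment\<close>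

text \<open>The inequality ln x \<le> x is applied twice: at x = t for the upper bound, and at x =
  1/t for the lower bound, where the factor t cancels.\<close>

lemma abs_mult_ln_le:
  fixes t :: real
  assumes "0 \<le> t"
  shows "\<bar>t * ln t\<bar> \<le> 1 + t * t"
proof (cases "t = 0")
  case False
  with assms have t: "0 < t" by simp
  have "ln t \<le> t" using ln_le_minus_one[OF t] by simp
  hence up: "t * ln t \<le> t * t" using t by (intro mult_left_mono) auto
  have "ln (1 / t) \<le> 1 / t" using ln_le_minus_one[of "1 / t"] t by simp
  hence "t * - ln t \<le> t * (1 / t)" using t by (intro mult_left_mono) (auto simp: ln_div)
  hence "- (t * ln t) \<le> 1" using t by simp
  moreover have "0 \<le> t * t" by simp
  ultimately show ?thesis using up unfolding abs_le_iff by linarith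
qed simp

text \<open>Domination by q + l^2 q. The finite second moment of the likelihood, the normaliser of
  the posterior given twice the dataset, is thus what makes the logarithmic moment finite.\<close>

lemma integrable_mult_ln_weighted:
  fixes l q :: "'a \<Rightarrow> real"
  assumes [measurable]: "l \<in> borel_measurable M" "q \<in> borel_measurable M"
    and nonneg: "\<And>z. z \<in> space M \<Longrightarrow> 0 \<le> l z" "\<And>z. z \<in> space M \<Longrightarrow> 0 \<le> q z"
    and "integrable M q" "integrable M (\<lambda>z. l z * l z * q z)"
  shows "integrable M (\<lambda>z. l z * ln (l z) * q z)"
proof (rule Bochner_Integration.integrable_bound)
  show "integrable M (\<lambda>z. q z + l z * l z * q z)"
    using assms by simp
  show "AE z in M. norm (l z * ln (l z) * q z) \<le> norm (q z + l z * l z * q z)"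
  proof (rule AE_I2)
    fix z assume z: "z \<in> space M"
    have "\<bar>l z * ln (l z)\<bar> * q z \<le> (1 + l z * l z) * q z"
      using nonneg[OF z] by (intro mult_right_mono abs_mult_ln_le) auto
    also have "\<dots> = norm (q z + l z * l z * q z)"
      using nonneg[OF z] by (simp add: algebra_simps)
    finally show "norm (l z * ln (l z) * q z) \<le> norm (q z + l z * l z * q z)"
      using nonneg[OF z] by (simp add: abs_mult)
  qed
qed simp

section \<open>Closed forms of the two divergences\<close>

text \<open>Rules out the infinite branch of \<open>KL\<close> once and for all, and lets the
  integrand be replaced by a form whose integral is already known.\<close>

lemma KL_eqI:
  assumes "\<And>z. z \<in> space M \<Longrightarrow> b z = 0 \<Longrightarrow> a z = 0"
    and "\<And>z. z \<in> space M \<Longrightarrow> a z * ln (a z / b z) = f z"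
    and f: "has_bochner_integral M f I"
  shows "KL M a b = ereal I"
proof -
  have "has_bochner_integral M (\<lambda>z. a z * ln (a z / b z)) I"
    using f by (subst has_bochner_integral_cong[OF refl assms(2) refl])
  moreover have "AE z in M. b z = 0 \<longrightarrow> a z = 0"
    using assms(1) by (intro AE_I2) blast
  ultimately show ?thesis
    unfolding KL_def by (auto simp: has_bochner_integral_iff)
qed

text \<open>Here \<open>a\<close> is the posterior given the dataset and \<open>b\<close> the one
  given its double. The ratios are a / q = l / c and a / b = d / (c l), so both logarithms are
  constants plus ln l, with opposite signs. Integrating against \<open>a\<close> turns ln l into L /
  c.\<close>

lemma
  fixes l q :: "'a \<Rightarrow> real"
  assumes nonneg: "\<And>z. z \<in> space M \<Longrightarrow> 0 \<le> l z" "\<And>z. z \<in> space M \<Longrightarrow> 0 \<le> q z"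
    and mass: "has_bochner_integral M (\<lambda>z. l z * q z) c" "0 < c"
    and L: "has_bochner_integral M (\<lambda>z. l z * ln (l z) * q z) L"
    and a: "\<And>z. z \<in> space M \<Longrightarrow> a z = l z * q z / c"
  shows KL_reweighted_base: "KL M a q = ereal (L / c - ln c)"
    and KL_reweighted_square:
      "\<lbrakk>0 < d; \<And>z. z \<in> space M \<Longrightarrow> b z = l z * l z * q z / d\<rbrakk> \<Longrightarrow>
        KL M a b = ereal (ln d - ln c - L / c)"
proof -
  show "KL M a q = ereal (L / c - ln c)"
  proof (rule KL_eqI)
    fix z assume z: "z \<in> space M"
    show "a z = 0" if "q z = 0" using that a[OF z] by simp
    show "a z * ln (a z / q z) = l z * ln (l z) * q z / c - l z * q z * (ln c / c)"
    \<comment> \<open>Logarithms of quotients split only for positive arguments. Where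
      \<open>q\<close> or \<open>l\<close> vanishes, the factors outside the logarithms make both
      sides 0, whatever value \<open>ln\<close> takes there.\<close>
    proof (cases "q z = 0 \<or> l z = 0")
      case False
      with nonneg[OF z] have pos: "0 < q z" "0 < l z" by auto
      have "a z / q z = l z / c"
        using a[OF z] pos by simp
      hence ln: "ln (a z / q z) = ln (l z) - ln c"
        using pos \<open>0 < c\<close> by (simp add: ln_div)
      show ?thesis
        unfolding ln unfolding a[OF z] using \<open>0 < c\<close> by (simp add: field_simps)
    qed (use a[OF z] in auto)
  next
    have "has_bochner_integral M (\<lambda>z. l z * ln (l z) * q z / c - l z * q z * (ln c / c))
        (L / c - c * (ln c / c))"
      using mass L by (intro has_bochner_integral_diff has_bochner_integral_divide_zero
          has_bochner_integral_mult_left) auto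
    then show "has_bochner_integral M
        (\<lambda>z. l z * ln (l z) * q z / c - l z * q z * (ln c / c)) (L / c - ln c)"
      using \<open>0 < c\<close> by simp
  qed
next
  assume d: "0 < d" and b: "\<And>z. z \<in> space M \<Longrightarrow> b z = l z * l z * q z / d"
  show "KL M a b = ereal (ln d - ln c - L / c)"
  proof (rule KL_eqI)
    fix z assume z: "z \<in> space M"
    show "a z = 0" if "b z = 0" using that a[OF z] b[OF z] d by auto
    show "a z * ln (a z / b z) =
        l z * q z * ((ln d - ln c) / c) - l z * ln (l z) * q z / c"
    proof (cases "q z = 0 \<or> l z = 0")
      case False
      with nonneg[OF z] have pos: "0 < q z" "0 < l z" by auto
      have "a z / b z = d / (c * l z)"
        unfolding a[OF z] b[OF z] using pos d \<open>0 < c\<close> by (simp add: field_simps)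
      hence ln: "ln (a z / b z) = ln d - ln c - ln (l z)"
        using pos d \<open>0 < c\<close> by (simp add: ln_div ln_mult)
      show ?thesis
        unfolding ln unfolding a[OF z] using \<open>0 < c\<close> by (simp add: field_simps)
    qed (use a[OF z] in auto)
  next
    have "has_bochner_integral M
        (\<lambda>z. l z * q z * ((ln d - ln c) / c) - l z * ln (l z) * q z / c)
        (c * ((ln d - ln c) / c) - L / c)"
      using mass L by (intro has_bochner_integral_diff has_bochner_integral_divide_zero
          has_bochner_integral_mult_left) auto
    then show "has_bochner_integral M
        (\<lambda>z. l z * q z * ((ln d - ln c) / c) - l z * ln (l z) * q z / c)
        (ln d - ln c - L / c)"
      using \<open>0 < c\<close> by simp
  qed
qed

section \<open>Variance of independent sums and of the sample mean\<close>

text \<open>After centring, independence makes every off-diagonal term of the expanded square vanish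
  in expectation. Square-integrability is a conclusion in its own right because \<open>SNR\<close>
  tests for it.\<close>

lemma (in prob_space)
  fixes X :: "'i \<Rightarrow> 'a \<Rightarrow> real"
  assumes I: "finite I"
    and indep: "indep_vars (\<lambda>_. borel) X I"
    and sq: "\<And>i. i \<in> I \<Longrightarrow> integrable M (\<lambda>\<omega>. (X i \<omega>)\<^sup>2)"
  shows square_integrable_sum_indep: "integrable M (\<lambda>\<omega>. (\<Sum>i\<in>I. X i \<omega>)\<^sup>2)"
    and variance_sum_indep: "variance (\<lambda>\<omega>. \<Sum>i\<in>I. X i \<omega>) = (\<Sum>i\<in>I. variance (X i))"
proof -
  have meas: "X i \<in> borel_measurable M" if "i \<in> I" for i
    using indep that unfolding indep_vars_def by auto
  have int: "integrable M (X i)" if "i \<in> I" for i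
    using square_integrable_imp_integrable[OF meas sq] that by blast
  define Y where "Y i \<omega> = X i \<omega> - expectation (X i)" for i \<omega>
  have intY: "integrable M (Y i)" and expY: "expectation (Y i) = 0" if "i \<in> I" for i
    using int[OF that] unfolding Y_def by (auto simp: prob_space)
  have indepY: "indep_vars (\<lambda>_. borel) Y I"
    unfolding Y_def using indep by (rule indep_vars_compose2) auto
  have off_diag: "integrable M (\<lambda>\<omega>. Y i \<omega> * Y j \<omega>)" "expectation (\<lambda>\<omega>. Y i \<omega> * Y j \<omega>) = 0"
    if "i \<in> I" "j \<in> I" "i \<noteq> j" for i j
  proof -
    \<comment> \<open>On a two-element index set, the product rules for independent families yield
      both integrability and the factorised expectation of the cross term.\<close>
    have ind: "indep_vars (\<lambda>_. borel) Y {i, j}"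
      using indep_vars_subset[OF indepY] that by simp
    show "integrable M (\<lambda>\<omega>. Y i \<omega> * Y j \<omega>)"
      using indep_vars_integrable[OF _ ind] intY that by auto
    show "expectation (\<lambda>\<omega>. Y i \<omega> * Y j \<omega>) = 0"
      using indep_vars_lebesgue_integral[OF _ ind] intY expY that by auto
  qed
  have diag: "integrable M (\<lambda>\<omega>. Y i \<omega> * Y i \<omega>)" if "i \<in> I" for i
    using sq[OF that] int[OF that]
    unfolding Y_def by (simp add: power2_eq_square left_diff_distrib right_diff_distrib)
  have prod: "integrable M (\<lambda>\<omega>. Y i \<omega> * Y j \<omega>)" if "i \<in> I" "j \<in> I" for i j
    using off_diag(1) diag that by (cases "i = j") auto
  have square: "(\<Sum>i\<in>I. Y i \<omega>)\<^sup>2 = (\<Sum>i\<in>I. \<Sum>j\<in>I. Y i \<omega> * Y j \<omega>)" for \<omega>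
    by (simp add: power2_eq_square sum_product)
  have int_square: "integrable M (\<lambda>\<omega>. (\<Sum>i\<in>I. Y i \<omega>)\<^sup>2)"
    unfolding square using prod by (intro Bochner_Integration.integrable_sum) auto
  define m where "m = (\<Sum>i\<in>I. expectation (X i))"
  have sumY: "(\<Sum>i\<in>I. Y i \<omega>) = (\<Sum>i\<in>I. X i \<omega>) - m" for \<omega>
    unfolding Y_def m_def by (simp add: sum_subtractf)
  have exp_sum: "expectation (\<lambda>\<omega>. \<Sum>i\<in>I. X i \<omega>) = m"
    unfolding m_def using int by (intro Bochner_Integration.integral_sum) auto
  \<comment> \<open>Undoes the centring: the raw sum is the centred sum plus \<open>m\<close>, and
    this is its square expanded.\<close>
  have "integrable M (\<lambda>\<omega>. (\<Sum>i\<in>I. Y i \<omega>)\<^sup>2 + 2 * m * (\<Sum>i\<in>I. Y i \<omega>) + m\<^sup>2)"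
    using int_square intY by (intro Bochner_Integration.integrable_add integrable_mult_right
        Bochner_Integration.integrable_sum) auto
  also have "(\<lambda>\<omega>. (\<Sum>i\<in>I. Y i \<omega>)\<^sup>2 + 2 * m * (\<Sum>i\<in>I. Y i \<omega>) + m\<^sup>2) =
      (\<lambda>\<omega>. (\<Sum>i\<in>I. X i \<omega>)\<^sup>2)"
    unfolding sumY by (auto simp: power2_eq_square algebra_simps)
  finally show "integrable M (\<lambda>\<omega>. (\<Sum>i\<in>I. X i \<omega>)\<^sup>2)" .
  have "variance (\<lambda>\<omega>. \<Sum>i\<in>I. X i \<omega>) = expectation (\<lambda>\<omega>. (\<Sum>i\<in>I. Y i \<omega>)\<^sup>2)"
    unfolding exp_sum sumY ..
  also have "\<dots> = (\<Sum>i\<in>I. \<Sum>j\<in>I. expectation (\<lambda>\<omega>. Y i \<omega> * Y j \<omega>))"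
    unfolding square using prod
    by (subst Bochner_Integration.integral_sum; (intro Bochner_Integration.integrable_sum
          sum.cong Bochner_Integration.integral_sum)?) auto
  also have "\<dots> = (\<Sum>i\<in>I. \<Sum>j\<in>I. if i = j then expectation (\<lambda>\<omega>. Y i \<omega> * Y i \<omega>) else 0)"
    using off_diag(2) by (intro sum.cong) auto
  also have "\<dots> = (\<Sum>i\<in>I. variance (X i))"
    using I by (simp add: Y_def power2_eq_square)
  finally show "variance (\<lambda>\<omega>. \<Sum>i\<in>I. X i \<omega>) = (\<Sum>i\<in>I. variance (X i))" .
qed

text \<open>Supplies the four facts that evaluating \<open>SNR\<close> requires. Only the first two
  moments \<open>m\<close> and \<open>s\<close> need to be common to the variables; each variance is
  then s - m^2, and scaling by 1/n turns the factor n of the summed variance into 1/n.\<close>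

lemma (in prob_space)
  fixes X :: "'i \<Rightarrow> 'a \<Rightarrow> real"
  assumes I: "finite I" "I \<noteq> {}"
    and indep: "indep_vars (\<lambda>_. borel) X I"
    and sq: "\<And>i. i \<in> I \<Longrightarrow> has_bochner_integral M (\<lambda>\<omega>. (X i \<omega>)\<^sup>2) s"
    and mean: "\<And>i. i \<in> I \<Longrightarrow> has_bochner_integral M (X i) m"
  defines "R \<equiv> \<lambda>\<omega>. 1 / real (card I) * (\<Sum>i\<in>I. X i \<omega>)"
  shows integrable_sample_mean: "integrable M R"
    and square_integrable_sample_mean: "integrable M (\<lambda>\<omega>. (R \<omega>)\<^sup>2)"
    and expectation_sample_mean: "expectation R = m"
    and variance_sample_mean: "variance R = (s - m\<^sup>2) / real (card I)"
proof -
  let ?S = "\<lambda>\<omega>. \<Sum>i\<in>I. X i \<omega>"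
  have card: "0 < real (card I)" using I by (simp add: card_gt_0_iff)
  have S: "has_bochner_integral M ?S (\<Sum>i\<in>I. m)"
    using mean by (intro has_bochner_integral_sum) auto
  have isq: "integrable M (\<lambda>\<omega>. (X i \<omega>)\<^sup>2)" if "i \<in> I" for i
    using sq[OF that] by (simp add: has_bochner_integral_iff)
  note S2 = square_integrable_sum_indep[OF I(1) indep isq]
  show "integrable M R" using S unfolding R_def by (simp add: has_bochner_integral_iff)
  show "integrable M (\<lambda>\<omega>. (R \<omega>)\<^sup>2)"
    using S2 unfolding R_def by (simp add: power_mult_distrib power_divide)
  show ER: "expectation R = m"
    using S card unfolding R_def by (simp add: has_bochner_integral_iff)
  have "variance (X i) = s - m\<^sup>2" if "i \<in> I" for i
    using variance_eq[of "X i"] sq[OF that] mean[OF that] by (simp add: has_bochner_integral_iff)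
  hence VS: "variance ?S = real (card I) * (s - m\<^sup>2)"
    using variance_sum_indep[OF I(1) indep isq] by simp
  have ES: "expectation ?S = real (card I) * m"
    using S by (simp add: has_bochner_integral_iff)
  have "variance R = expectation (\<lambda>\<omega>. (1 / real (card I))\<^sup>2 * (?S \<omega> - expectation ?S)\<^sup>2)"
    unfolding ER ES unfolding R_def using card
    by (intro arg_cong[where f = expectation] ext)
       (simp add: power2_eq_square field_simps)
  also have "\<dots> = (1 / real (card I))\<^sup>2 * variance ?S" by simp
  also have "\<dots> = (s - m\<^sup>2) / real (card I)"
    unfolding VS using card by (simp add: power2_eq_square)
  finally show "variance R = (s - m\<^sup>2) / real (card I)" .
qed

section \<open>Passing between extended integrals, densities and expectations\<close>

text \<open>Turns the well-definedness of a posterior, stated with the extended integral, into an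
  integrable normaliser that can be divided by.\<close>

lemma nn_integral_pos_finite_imp_integral_pos:
  fixes f :: "'a \<Rightarrow> real"
  assumes "f \<in> borel_measurable M" "\<And>z. z \<in> space M \<Longrightarrow> 0 \<le> f z"
    and fin: "(\<integral>\<^sup>+ z. ennreal (f z) \<partial>M) \<in> {0<..<\<infinity>}"
  shows "has_bochner_integral M f (integral\<^sup>L M f)" "0 < integral\<^sup>L M f"
proof -
  have "integrable M f"
    using assms by (intro integrableI_nonneg) auto
  moreover from this have "(\<integral>\<^sup>+ z. ennreal (f z) \<partial>M) = ennreal (integral\<^sup>L M f)"
    using assms by (intro nn_integral_eq_integral) auto
  ultimately show "has_bochner_integral M f (integral\<^sup>L M f)" "0 < integral\<^sup>L M f"
    using fin by (auto simp: has_bochner_integral_iff)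
qed

text \<open>Change of variables: moments of the likelihood at a sample become integrals against the
  density it is drawn from.\<close>

lemma has_bochner_integral_distributed:
  fixes g f :: "'a \<Rightarrow> real"
  assumes "distributed P M X f" "g \<in> borel_measurable M" "\<And>x. x \<in> space M \<Longrightarrow> 0 \<le> f x"
    and "has_bochner_integral M (\<lambda>x. f x * g x) I"
  shows "has_bochner_integral P (\<lambda>\<omega>. g (X \<omega>)) I"
  using distributed_integrable[OF assms(1-3)] distributed_integral[OF assms(1-3)] assms(4)
  by (simp add: has_bochner_integral_iff)

section \<open>Signal-to-noise ratio in terms of the divergences\<close>

theorem theorem4:
  fixes M :: "'z measure"
    and P :: "'w measure"
    and p :: "'x multiset \<Rightarrow> 'z \<Rightarrow> real"
    and q :: "'x multiset \<Rightarrow> 'z \<Rightarrow> real"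
    and D Dstar :: "'x multiset"
    and K :: nat
    and z :: "nat \<Rightarrow> 'w \<Rightarrow> 'z"
  assumes lik: "factorizing_likelihood M p"
    and q: "prob_density M (q D)"
    and wd1: "(\<integral>\<^sup>+ z. ennreal (p Dstar z * q D z) \<partial>M) \<in> {0<..<\<infinity>}"
    and wd2: "(\<integral>\<^sup>+ z. ennreal (p (Dstar + Dstar) z * q D z) \<partial>M) \<in> {0<..<\<infinity>}"
    and K: "K \<ge> 1"
    and P: "prob_space P"
    and indep: "prob_space.indep_vars P (\<lambda>_. M) z {1..K}"
    and distr: "\<And>k. k \<in> {1..K} \<Longrightarrow> distributed P M (z k) (\<lambda>x. ennreal (q D x))"
  shows "\<exists>\<delta>::real.
     ereal \<delta> = ereal (1/2) * KL M (posterior M p (q D) Dstar) (q D)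
             + ereal (1/2) * KL M (posterior M p (q D) Dstar) (posterior M p (q D) (Dstar + Dstar)) \<and>
     \<delta> = 1/2 * log_evidence M p (q D) (Dstar + Dstar) - log_evidence M p (q D) Dstar \<and>
     SNR P (mc_estimator p Dstar K z) =
       (if \<delta> = 0 then \<infinity> else ereal (sqrt (real K) / sqrt ((exp \<delta>)\<^sup>2 - 1)))"
proof -
  define l where "l = p Dstar"
  define c where "c = (\<integral>z. l z * q D z \<partial>M)"
  define d where "d = (\<integral>z. p (Dstar + Dstar) z * q D z \<partial>M)"
  define L where "L = (\<integral>z. l z * ln (l z) * q D z \<partial>M)"
  have [measurable]: "\<And>A. p A \<in> borel_measurable M"
    and p_nonneg: "\<And>A z. z \<in> space M \<Longrightarrow> 0 \<le> p A z"
    and p_mult: "\<And>z. z \<in> space M \<Longrightarrow> p (Dstar + Dstar) z = l z * l z"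
    using lik unfolding factorizing_likelihood_def l_def by auto
  have [measurable]: "q D \<in> borel_measurable M" and q_nonneg: "\<And>z. z \<in> space M \<Longrightarrow> 0 \<le> q D z"
    using q unfolding prob_density_def by auto
  have [measurable]: "l \<in> borel_measurable M" and l_nonneg: "\<And>z. z \<in> space M \<Longrightarrow> 0 \<le> l z"
    unfolding l_def using p_nonneg by auto
  have int_q: "integrable M (q D)"
    using q unfolding prob_density_def by (intro integrableI_nonneg) auto
  have c: "has_bochner_integral M (\<lambda>z. l z * q D z) c" "0 < c"
    using nn_integral_pos_finite_imp_integral_pos[OF _ _ wd1] p_nonneg q_nonneg
    unfolding c_def l_def by auto
  have "has_bochner_integral M (\<lambda>z. p (Dstar + Dstar) z * q D z) d" and d_pos: "0 < d"
    using nn_integral_pos_finite_imp_integral_pos[OF _ _ wd2] p_nonneg q_nonneg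
    unfolding d_def by auto
  then have d: "has_bochner_integral M (\<lambda>z. l z * l z * q D z) d"
    \<comment> \<open>The likelihood is multiplicative only on \<open>space M\<close>, so the
      integrand is exchanged by congruence there.\<close>
    by (subst has_bochner_integral_cong[OF refl _ refl]) (simp_all add: p_mult)
  have L: "has_bochner_integral M (\<lambda>z. l z * ln (l z) * q D z) L"
    unfolding L_def using l_nonneg q_nonneg int_q d
    by (intro has_bochner_integral_integrable integrable_mult_ln_weighted)
       (auto simp: has_bochner_integral_iff)
  have post1: "posterior M p (q D) Dstar z = l z * q D z / c" for z
    unfolding posterior_def l_def c_def ..
  have post2: "posterior M p (q D) (Dstar + Dstar) z = l z * l z * q D z / d"
    if "z \<in> space M" for z
    unfolding posterior_def d_def p_mult[OF that] ..
  have KL1: "KL M (posterior M p (q D) Dstar) (q D) = ereal (L / c - ln c)"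
    by (rule KL_reweighted_base[OF l_nonneg q_nonneg c L post1])
  have KL2: "KL M (posterior M p (q D) Dstar) (posterior M p (q D) (Dstar + Dstar)) =
      ereal (ln d - ln c - L / c)"
    by (rule KL_reweighted_square[OF l_nonneg q_nonneg c L post1 d_pos post2])
  define \<delta> where "\<delta> = 1/2 * ln d - ln c"
  have exp_\<delta>: "(exp \<delta>)\<^sup>2 = d / c\<^sup>2"
  proof -
    have "(exp \<delta>)\<^sup>2 = exp (ln d - (ln c + ln c))"
      unfolding \<delta>_def power2_eq_square exp_add[symmetric] by (simp add: algebra_simps)
    also have "\<dots> = d / c\<^sup>2"
      unfolding exp_diff exp_add using c(2) d_pos by (simp add: power2_eq_square)
    finally show ?thesis .
  qed
  \<comment> \<open>Matches the case \<delta> = 0 of the claim with the zero-variance branch of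
    \<open>SNR\<close>.\<close>
  have \<delta>_0: "\<delta> = 0 \<longleftrightarrow> d - c\<^sup>2 = 0"
  proof -
    have "\<delta> = 0 \<longleftrightarrow> (exp \<delta>)\<^sup>2 = 1"
      unfolding exp_double[symmetric] by simp
    then show ?thesis unfolding exp_\<delta> using c(2) by auto
  qed
  interpret prob_space P by (rule P)
  have indep_l: "indep_vars (\<lambda>_. borel) (\<lambda>k \<omega>. l (z k \<omega>)) {1..K}"
    using indep by (rule indep_vars_compose2) simp
  have m1: "has_bochner_integral P (\<lambda>\<omega>. l (z k \<omega>)) c" if "k \<in> {1..K}" for k
    using c(1) by (intro has_bochner_integral_distributed[OF distr[OF that]])
      (auto simp: q_nonneg mult.commute)
  have m2: "has_bochner_integral P (\<lambda>\<omega>. (l (z k \<omega>))\<^sup>2) d" if "k \<in> {1..K}" for k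
    using d by (intro has_bochner_integral_distributed[OF distr[OF that], where g = "\<lambda>x. (l x)\<^sup>2"])
      (auto simp: q_nonneg mult_ac power2_eq_square)
  have R: "mc_estimator p Dstar K z =
      (\<lambda>\<omega>. 1 / real (card {1..K}) * (\<Sum>k\<in>{1..K}. l (z k \<omega>)))"
    unfolding mc_estimator_def l_def by auto
  have ne: "{1..K} \<noteq> {}" using K by simp
  note sample = indep_l m2 m1
  \<comment> \<open>The moments are finite, so the default 0 for infinite variance does not
    occur.\<close>
  have SNR: "SNR P (mc_estimator p Dstar K z) =
      (if (d - c\<^sup>2) / real K = 0 then \<infinity> else ereal (c / sqrt ((d - c\<^sup>2) / real K)))"
    unfolding SNR_def R
    using integrable_sample_mean[OF finite_atLeastAtMost ne sample]
      square_integrable_sample_mean[OF finite_atLeastAtMost ne sample]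
      expectation_sample_mean[OF finite_atLeastAtMost ne sample]
      variance_sample_mean[OF finite_atLeastAtMost ne sample]
    by simp
  \<comment> \<open>The relative variance of a single sample is d / c^2 - 1; in the quotient below,
    \<open>c\<close> cancels against sqrt (c^2) because it is positive. At \<delta> = 0 that
    quotient identity reads 0 = 0 by division by zero, and the case split discards it.\<close>
  have "d - c\<^sup>2 = c\<^sup>2 * ((exp \<delta>)\<^sup>2 - 1)"
    unfolding exp_\<delta> using c(2) by (simp add: field_simps)
  hence "c / sqrt ((d - c\<^sup>2) / real K) = sqrt (real K) / sqrt ((exp \<delta>)\<^sup>2 - 1)"
    using c(2) K by (simp add: real_sqrt_divide real_sqrt_mult)
  with SNR K have "SNR P (mc_estimator p Dstar K z) =
      (if \<delta> = 0 then \<infinity> else ereal (sqrt (real K) / sqrt ((exp \<delta>)\<^sup>2 - 1)))"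
    unfolding \<delta>_0 by simp
  moreover have "ereal \<delta> =
      ereal (1/2) * KL M (posterior M p (q D) Dstar) (q D)
      + ereal (1/2) * KL M (posterior M p (q D) Dstar) (posterior M p (q D) (Dstar + Dstar))"
    unfolding KL1 KL2 \<delta>_def by (simp add: field_simps)
  moreover have "\<delta> = 1/2 * log_evidence M p (q D) (Dstar + Dstar) - log_evidence M p (q D) Dstar"
    unfolding \<delta>_def log_evidence_def c_def d_def l_def ..
  ultimately show ?thesis by blast
qed

end
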